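(* Let $\frac{a}{b} < \frac{c}{d}$ be any two non-negative rational numbers written in lowest terms. Then the tree $T\left(\frac{a}{b}, \frac{c}{d}\right)$ contains all rational numbers in the interval $\left[\frac{a}{b}, \frac{c}{d}\right]$.
   Context: All fractions are written in lowest terms with positive denominator. The mediant of two reduced fractions $\frac{p}{q}$ and $\frac{r}{s}$ is the fraction $\frac{p+r}{q+s}$ put in lowest terms. Given two non-negative rational numbers $\frac{a}{b} < \frac{c}{d}$ in lowest terms, define finite sequences (rows) $S_n\left(\frac{a}{b},\frac{c}{d}\right)$, $n \ge 0$, of reduced fractions: $S_0 = \left(\frac{a}{b}, \frac{c}{d}\right)$, and $S_{n+1}$ is obtained from $S_n$ by copying all terms and inserting between every two consecutive terms their (reduced) mediant, where the mediant is computed from the reduced forms of the two terms. The tree $T\left(\frac{a}{b},\frac{c}{d}\right)$ is the collection of all the rows $S_n\left(\frac{a}{b},\frac{c}{d}\right)$, $n\ge 0$; a rational number appears in (is contained in) the tree if it is a term of some row. *)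

theory Defs
  imports Complex_Main
begin

text \<open>A reduced fraction with positive denominator is represented by its value in \<^typ>\<open>rat\<close>;
  \<^const>\<open>quotient_of\<close> recovers the numerator and denominator in lowest terms, so that
  the mediant is always formed from reduced representations, and its value in \<^typ>\<open>rat\<close>
  stands for the mediant put in lowest terms.\<close>

definition mediant :: "rat \<Rightarrow> rat \<Rightarrow> rat" where
  "mediant x y =
     (let (p, q) = quotient_of x; (r, s) = quotient_of y in Fract (p + r) (q + s))"

fun insert_mediants :: "rat list \<Rightarrow> rat list" where
  "insert_mediants [] = []"
| "insert_mediants [x] = [x]"
| "insert_mediants (x # y # zs) = x # mediant x y # insert_mediants (y # zs)"

primrec row :: "rat \<Rightarrow> rat \<Rightarrow> nat \<Rightarrow> rat list" where
  "row x y 0 = [x, y]"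
| "row x y (Suc n) = insert_mediants (row x y n)"

definition mediant_tree :: "rat \<Rightarrow> rat \<Rightarrow> rat list set" where
  "mediant_tree x y = {row x y n | n. True}"

definition appears_in :: "rat \<Rightarrow> rat list set \<Rightarrow> bool" where
  "appears_in z T \<longleftrightarrow> (\<exists>S\<in>T. z \<in> set S)"

end

theory Submission
  imports Defs
begin

text \<open>Suppose \<open>z = m/n\<close> lies strictly between consecutive terms \<open>p/q < r/s\<close> of a row and put
  \<open>\<Delta> = r q - p s\<close>. Since \<open>n \<Delta> = (m q - n p) s + (r n - s m) q\<close> with positive integers in
  parentheses, \<open>\<mu> = n \<Delta> - (q + s)\<close> is non-negative. If the mediant cancels by \<open>g\<close>, then
  replacing one of the two terms by it divides both \<open>\<Delta>\<close> and \<open>q + s\<close> by \<open>g\<close> and then adds the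
  denominator of the kept term, so \<open>\<mu>\<close> becomes \<open>\<mu> / g - q\<close> or \<open>\<mu> / g - s\<close>, which is smaller.
  Hence the descent towards \<open>z\<close> stops, and it can only stop at \<open>z\<close>.\<close>

definition num :: "rat \<Rightarrow> int" where "num x = fst (quotient_of x)"

definition den :: "rat \<Rightarrow> int" where "den x = snd (quotient_of x)"

text \<open>The \<Delta> of the overview: the numerator of \<open>y - x\<close> over the denominator
  \<open>den x * den y\<close>, which explains its sign.\<close>

definition det :: "rat \<Rightarrow> rat \<Rightarrow> int" where
  "det x y = num y * den x - num x * den y"

lemma den_pos: "den x > 0"
  by (simp add: den_def quotient_of_denom_pos')

lemma coprime_num_den: "coprime (num x) (den x)"
  by (simp add: num_def den_def quotient_of_coprime)

lemma Fract_num_den: "Fract (num x) (den x) = x"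
  by (metis Fract_of_int_quotient den_def num_def prod.collapse quotient_of_div)

lemma less_iff_det_pos: "x < y \<longleftrightarrow> det x y > 0"
proof -
  have "x < y \<longleftrightarrow> Fract (num x) (den x) < Fract (num y) (den y)"
    by (simp add: Fract_num_den)
  also have "\<dots> \<longleftrightarrow> det x y > 0"
    using den_pos[of x] den_pos[of y] by (simp add: det_def less_rat zero_less_mult_iff)
  finally show ?thesis .
qed

text \<open>Here \<open>g\<close> is the factor lost in reducing the mediant. It exists because a
  reduced denominator divides every other denominator of the same value.\<close>

lemma mediant_cancel:
  obtains g where "g > 0" "num x + num y = g * num (mediant x y)"
    "den x + den y = g * den (mediant x y)"
proof -
  let ?m = "mediant x y"
  have pos: "den x + den y > 0" "den ?m > 0"
    using den_pos[of x] den_pos[of y] den_pos[of ?m] by auto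
  have "Fract (num x + num y) (den x + den y) = Fract (num ?m) (den ?m)"
    by (simp add: Fract_num_den) (simp add: mediant_def num_def den_def case_prod_beta)
  then have eq: "(num x + num y) * den ?m = num ?m * (den x + den y)"
    using pos by (simp add: eq_rat)
  then have "den ?m dvd num ?m * (den x + den y)"
    by (metis dvd_triv_right)
  then have "den ?m dvd den x + den y"
    using coprime_num_den[of ?m] by (simp add: coprime_commute coprime_dvd_mult_right_iff)
  then obtain g where g: "den x + den y = g * den ?m"
    by (auto simp: dvd_def mult.commute)
  show thesis
  proof
    show "g > 0" using g pos by (metis zero_less_mult_pos2)
    show "den x + den y = g * den ?m" by (fact g)
    show "num x + num y = g * num ?m" using eq pos g by simp
  qed
qed

text \<open>The \<mu> of the overview, with \<open>z\<close> the target. It is kept in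
  \<open>int\<close> because it can be negative when \<open>z\<close> is not strictly between
  \<open>x\<close> and \<open>y\<close>.\<close>

definition descent_measure :: "rat \<Rightarrow> rat \<Rightarrow> rat \<Rightarrow> int" where
  "descent_measure z x y = den z * det x y - (den x + den y)"

lemma descent_measure_nonneg:
  assumes "x < z" "z < y"
  shows "descent_measure z x y \<ge> 0"
proof -
  \<comment> \<open>With fractions read as vectors (numerator, denominator), \<open>det x y\<close>
    times \<open>z\<close> is \<open>det z y\<close> times \<open>x\<close> plus
    \<open>det x z\<close> times \<open>y\<close>; this is the second coordinate.\<close>
  have "den z * det x y = det x z * den y + det z y * den x"
    by (simp add: det_def algebra_simps)
  moreover have "1 * den y \<le> det x z * den y" "1 * den x \<le> det z y * den x"
    using assms den_pos[of x] den_pos[of y] unfolding less_iff_det_pos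
    by (intro mult_right_mono; simp)+
  ultimately show ?thesis by (simp add: descent_measure_def)
qed

lemma descent_measure_mediant_less:
  assumes "descent_measure z x y \<ge> 0"
  shows "descent_measure z x (mediant x y) < descent_measure z x y"
    and "descent_measure z (mediant x y) y < descent_measure z x y"
proof -
  let ?m = "mediant x y"
  obtain g where g: "g > 0" "num x + num y = g * num ?m" "den x + den y = g * den ?m"
    by (rule mediant_cancel)
  \<comment> \<open>As vectors, \<open>g\<close> times the mediant is the sum of \<open>x\<close>
    and \<open>y\<close>; the determinant is bilinear and vanishes on equal arguments.\<close>
  have "g * det x ?m = (num x + num y) * den x - num x * (den x + den y)"
    by (simp add: g det_def algebra_simps)
  then have l: "g * det x ?m = det x y"
    by (simp add: det_def algebra_simps)
  have "g * det ?m y = num y * (den x + den y) - (num x + num y) * den y"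
    by (simp add: g det_def algebra_simps)
  then have r: "g * det ?m y = det x y"
    by (simp add: det_def algebra_simps)
  \<comment> \<open>This is \<mu> / \<open>g\<close>; subtracting \<open>den x\<close> or
    \<open>den y\<close> gives the measure of the left or right half.\<close>
  define k where "k = den z * det x ?m - den ?m"
  have "det ?m y = det x ?m"
    using l r g(1) by (metis less_irrefl mult_left_cancel)
  then have k': "k = den z * det ?m y - den ?m" by (simp add: k_def)
  have eq: "descent_measure z x y = g * k"
    by (simp add: descent_measure_def k_def g(3) l[symmetric] algebra_simps)
  \<comment> \<open>The sign matters: only for a non-negative measure does division by
    \<open>g\<close> not increase it.\<close>
  then have "k \<ge> 0" using assms g(1) by (simp add: zero_le_mult_iff)
  then have "1 * k \<le> g * k" using g(1) by (intro mult_right_mono) auto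
  then have "k \<le> descent_measure z x y" by (simp add: eq)
  then show "descent_measure z x ?m < descent_measure z x y"
    and "descent_measure z ?m y < descent_measure z x y"
    using den_pos[of x] den_pos[of y] unfolding descent_measure_def[of z x ?m]
      descent_measure_def[of z ?m y] using k_def k' by linarith+
qed

text \<open>Insertion is local. The mediant just before \<open>x\<close> goes into
  \<open>us'\<close>, so the rest can be expanded independently of the prefix.\<close>

lemma insert_mediants_append:
  "\<exists>us'. insert_mediants (us @ x # vs) = us' @ insert_mediants (x # vs)"
proof (induction us rule: insert_mediants.induct)
  case (2 u)
  have "insert_mediants ([u] @ x # vs) = [u, mediant u x] @ insert_mediants (x # vs)" by simp
  then show ?case by blast
next
  case (3 u v us)
  then obtain us' where "insert_mediants ((v # us) @ x # vs) = us' @ insert_mediants (x # vs)"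
    by blast
  then have "insert_mediants ((u # v # us) @ x # vs)
      = (u # mediant u v # us') @ insert_mediants (x # vs)" by simp
  then show ?case by blast
qed simp

definition consecutive :: "'a \<Rightarrow> 'a \<Rightarrow> 'a list \<Rightarrow> bool" where
  "consecutive x y xs \<longleftrightarrow> (\<exists>us vs. xs = us @ x # y # vs)"

lemma consecutive_insert_mediants:
  assumes "consecutive x y xs"
  shows "consecutive x (mediant x y) (insert_mediants xs)"
    and "consecutive (mediant x y) y (insert_mediants xs)"
proof -
  obtain us vs where xs: "xs = us @ x # y # vs"
    using assms by (auto simp: consecutive_def)
  obtain us' where us': "insert_mediants xs = us' @ insert_mediants (x # y # vs)"
    unfolding xs using insert_mediants_append by blast
  \<comment> \<open>The first term is always kept, whether or not \<open>y\<close> ends the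
    row.\<close>
  obtain vs' where "insert_mediants (y # vs) = y # vs'"
    by (cases vs) auto
  then have eq: "insert_mediants xs = us' @ x # mediant x y # y # vs'"
    using us' by simp
  then show "consecutive x (mediant x y) (insert_mediants xs)"
    unfolding consecutive_def by blast
  have "insert_mediants xs = (us' @ [x]) @ mediant x y # y # vs'"
    using eq by simp
  then show "consecutive (mediant x y) y (insert_mediants xs)"
    unfolding consecutive_def by blast
qed

text \<open>The row index \<open>n\<close> is generalized because every descent step passes to the
  next row.\<close>

lemma between_consecutive_in_row:
  assumes "consecutive x y (row a b n)" "x \<le> z" "z \<le> y"
  shows "\<exists>k. z \<in> set (row a b k)"
  using assms
proof (induction "nat (descent_measure z x y)" arbitrary: x y n rule: less_induct)
  case less
  show ?case
  proof (cases "z = x \<or> z = y")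
    case True
    then have "z \<in> set (row a b n)"
      using less.prems(1) by (auto simp: consecutive_def)
    then show ?thesis ..
  next
    case False
    with less.prems have nonneg: "descent_measure z x y \<ge> 0"
      by (intro descent_measure_nonneg) auto
    let ?m = "mediant x y"
    show ?thesis
    proof (cases z ?m rule: linorder_cases)
      case lt: less
      \<comment> \<open>Non-negativity of the smaller measure makes the decrease strict after
        truncation by \<open>nat\<close>.\<close>
      then have "descent_measure z x ?m \<ge> 0"
        using less.prems False by (intro descent_measure_nonneg) auto
      then have "nat (descent_measure z x ?m) < nat (descent_measure z x y)"
        using descent_measure_mediant_less(1)[OF nonneg] by linarith
      moreover have "consecutive x ?m (row a b (Suc n))"
        using less.prems(1) by (simp add: consecutive_insert_mediants)
      ultimately show ?thesis
        using less.hyps less.prems(2) lt by (meson less_imp_le)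
    next
      case equal
      have "consecutive x ?m (row a b (Suc n))"
        using less.prems(1) by (simp add: consecutive_insert_mediants)
      then have "z \<in> set (row a b (Suc n))"
        by (auto simp: consecutive_def equal)
      then show ?thesis ..
    next
      case gt: greater
      then have "descent_measure z ?m y \<ge> 0"
        using less.prems False by (intro descent_measure_nonneg) auto
      then have "nat (descent_measure z ?m y) < nat (descent_measure z x y)"
        using descent_measure_mediant_less(2)[OF nonneg] by linarith
      moreover have "consecutive ?m y (row a b (Suc n))"
        using less.prems(1) by (simp add: consecutive_insert_mediants)
      ultimately show ?thesis
        using less.hyps less.prems(3) gt by (meson less_imp_le)
    qed
  qed
qed

theorem theorem3p7:
  fixes a b c d :: int
  assumes "b > 0" and "coprime a b"
    and "d > 0" and "coprime c d"
    and "0 \<le> Fract a b"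
    and "Fract a b < Fract c d"
  shows "\<forall>z \<in> {Fract a b .. Fract c d}. appears_in z (mediant_tree (Fract a b) (Fract c d))"
proof
  fix z assume z: "z \<in> {Fract a b .. Fract c d}"
  have "consecutive (Fract a b) (Fract c d) (row (Fract a b) (Fract c d) 0)"
    unfolding consecutive_def by (intro exI[of _ "[]"]) simp
  then obtain k where "z \<in> set (row (Fract a b) (Fract c d) k)"
    using z between_consecutive_in_row by (meson atLeastAtMost_iff)
  then show "appears_in z (mediant_tree (Fract a b) (Fract c d))"
    by (auto simp: appears_in_def mediant_tree_def)
qed

end
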